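(* Let $\mathbb{D}$ be the open unit disk in $\mathbb{C}$ and let $X\subset\mathcal{H}(\mathbb{D})$ be a Banach space of analytic functions that satisfies Axioms (A1), (A2), (A3), (A4) and (A6) listed in the context. Let $F\in\mathcal{H}(\mathbb{D})$ and let $\phi:\mathbb{D}\to\mathbb{D}$ be analytic. If the weighted composition operator $W_{F,\phi}f=F\,(f\circ\phi)$ maps $X$ onto $X$ and is an isometry of $X$ (that is, $\|W_{F,\phi}f\|=\|f\|$ for all $f\in X$), then $F$ is a constant function of modulus one and $\phi$ is a rotation, that is, $\phi(z)=cz$ for all $z\in\mathbb{D}$, for some constant $c$ with $|c|=1$.
   Context: $\mathcal{H}(\mathbb{D})$ is the algebra of all complex-valued analytic functions in $\mathbb{D}$, and $H^\infty(\mathbb{D})$ is the set of bounded functions in $\mathcal{H}(\mathbb{D})$. $X$ is a complex linear subspace of $\mathcal{H}(\mathbb{D})$ equipped with a norm $\|\cdot\|$ that makes it a Banach space. For $F\in\mathcal{H}(\mathbb{D})$ and an analytic map $\phi:\mathbb{D}\to\mathbb{D}$, the weighted composition operator with symbols $F$ and $\phi$ is defined by $W_{F,\phi}f=F\,(f\circ\phi)$. Axioms: (A1) For every $z\in\mathbb{D}$ the point evaluation functional $\Lambda_z:f\mapsto f(z)$ is bounded on $X$. (A2) $\mathbf{1}\in X$, where $\mathbf{1}(z)\equiv 1$. (A3) Whenever $f\in X$, the function $\chi f$ is also in $X$, where $\chi(z)\equiv z$. (A4) For every $u\in H^\infty(\mathbb{D})$ that does not vanish in $\mathbb{D}$ and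 every $f\in X$: if $fu^n\in X$ for all $n\in\mathbb{N}=\{1,2,3,\ldots\}$, then $fu^\alpha\in X$ for some positive non-integer value $\alpha$. Here $u^\alpha=\exp(\alpha\log u)$ for an analytic branch of $\log u$ in $\mathbb{D}$ (the choice of branch only changes $u^\alpha$ by a unimodular constant factor). (A6) The norm in $X$ is given by the formula $\|f\|=|f(0)|+p(f)$, where $p$ is a seminorm on $X$ which is translation-invariant: $p(f+C)=p(f)$ for all $f\in X$ and all $C\in\mathbb{C}$. *)

theory Defs
  imports "HOL-Complex_Analysis.Complex_Analysis"
begin

abbreviation unit_disk :: "complex set" where
  "unit_disk \<equiv> ball 0 1"

text \<open>
  A function defined on the unit disk is represented by the total function that agrees with it
  there and is 0 elsewhere, so that HOL equality of such functions is equality on the disk.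
\<close>

definition analytic_disk :: "(complex \<Rightarrow> complex) set" where
  "analytic_disk = {f. f holomorphic_on unit_disk \<and> (\<forall>z. z \<notin> unit_disk \<longrightarrow> f z = 0)}"

definition H_infinity :: "(complex \<Rightarrow> complex) set" where
  "H_infinity = {f \<in> analytic_disk. bounded (f ` unit_disk)}"

definition disk_const :: "complex \<Rightarrow> complex \<Rightarrow> complex" where
  "disk_const c = (\<lambda>z. if z \<in> unit_disk then c else 0)"

definition linear_subspace :: "(complex \<Rightarrow> complex) set \<Rightarrow> bool" where
  "linear_subspace X \<longleftrightarrow>
     (\<lambda>z. 0) \<in> X \<and>
     (\<forall>f\<in>X. \<forall>g\<in>X. (\<lambda>z. f z + g z) \<in> X) \<and>
     (\<forall>c. \<forall>f\<in>X. (\<lambda>z. c * f z) \<in> X)"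

definition seminorm_on ::
  "(complex \<Rightarrow> complex) set \<Rightarrow> ((complex \<Rightarrow> complex) \<Rightarrow> real) \<Rightarrow> bool" where
  "seminorm_on X p \<longleftrightarrow>
     (\<forall>f\<in>X. 0 \<le> p f) \<and>
     (\<forall>c. \<forall>f\<in>X. p (\<lambda>z. c * f z) = cmod c * p f) \<and>
     (\<forall>f\<in>X. \<forall>g\<in>X. p (\<lambda>z. f z + g z) \<le> p f + p g)"

definition norm_on ::
  "(complex \<Rightarrow> complex) set \<Rightarrow> ((complex \<Rightarrow> complex) \<Rightarrow> real) \<Rightarrow> bool" where
  "norm_on X N \<longleftrightarrow> seminorm_on X N \<and> (\<forall>f\<in>X. N f = 0 \<longrightarrow> f = (\<lambda>z. 0))"

definition complete_on ::
  "(complex \<Rightarrow> complex) set \<Rightarrow> ((complex \<Rightarrow> complex) \<Rightarrow> real) \<Rightarrow> bool" where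
  "complete_on X N \<longleftrightarrow>
     (\<forall>s :: nat \<Rightarrow> complex \<Rightarrow> complex.
        (\<forall>n. s n \<in> X) \<and>
        (\<forall>e>0. \<exists>M. \<forall>m\<ge>M. \<forall>n\<ge>M. N (\<lambda>z. s m z - s n z) < e) \<longrightarrow>
        (\<exists>f\<in>X. (\<lambda>n. N (\<lambda>z. s n z - f z)) \<longlonglongrightarrow> 0))"

definition banach_space_of_analytic ::
  "(complex \<Rightarrow> complex) set \<Rightarrow> ((complex \<Rightarrow> complex) \<Rightarrow> real) \<Rightarrow> bool" where
  "banach_space_of_analytic X N \<longleftrightarrow>
     X \<subseteq> analytic_disk \<and> linear_subspace X \<and> norm_on X N \<and> complete_on X N"

definition axiom_A1 ::
  "(complex \<Rightarrow> complex) set \<Rightarrow> ((complex \<Rightarrow> complex) \<Rightarrow> real) \<Rightarrow> bool" where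
  "axiom_A1 X N \<longleftrightarrow> (\<forall>z\<in>unit_disk. \<exists>C. \<forall>f\<in>X. cmod (f z) \<le> C * N f)"

definition axiom_A2 :: "(complex \<Rightarrow> complex) set \<Rightarrow> bool" where
  "axiom_A2 X \<longleftrightarrow> disk_const 1 \<in> X"

definition axiom_A3 :: "(complex \<Rightarrow> complex) set \<Rightarrow> bool" where
  "axiom_A3 X \<longleftrightarrow> (\<forall>f\<in>X. (\<lambda>z. z * f z) \<in> X)"

definition log_branch :: "(complex \<Rightarrow> complex) \<Rightarrow> (complex \<Rightarrow> complex) \<Rightarrow> bool" where
  "log_branch L u \<longleftrightarrow> L holomorphic_on unit_disk \<and> (\<forall>z\<in>unit_disk. exp (L z) = u z)"

text \<open>
  Two branches of the logarithm differ by a constant, so changing the branch \<open>L\<close> below multiplies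
  the function by a nonzero constant; on a linear subspace the choice of \<open>L\<close> is immaterial.
\<close>

definition axiom_A4 :: "(complex \<Rightarrow> complex) set \<Rightarrow> bool" where
  "axiom_A4 X \<longleftrightarrow>
     (\<forall>u\<in>H_infinity. \<forall>f\<in>X.
        (\<forall>z\<in>unit_disk. u z \<noteq> 0) \<and> (\<forall>n::nat. n \<ge> 1 \<longrightarrow> (\<lambda>z. f z * u z ^ n) \<in> X) \<longrightarrow>
        (\<exists>\<alpha>::real. \<alpha> > 0 \<and> \<alpha> \<notin> \<int> \<and>
           (\<exists>L. log_branch L u \<and> (\<lambda>z. f z * exp (of_real \<alpha> * L z)) \<in> X)))"

definition axiom_A6 ::
  "(complex \<Rightarrow> complex) set \<Rightarrow> ((complex \<Rightarrow> complex) \<Rightarrow> real) \<Rightarrow> bool" where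
  "axiom_A6 X N \<longleftrightarrow>
     (\<exists>p. seminorm_on X p \<and>
          (\<forall>f\<in>X. \<forall>C. p (\<lambda>z. f z + disk_const C z) = p f) \<and>
          (\<forall>f\<in>X. N f = cmod (f 0) + p f))"

definition weighted_comp ::
  "(complex \<Rightarrow> complex) \<Rightarrow> (complex \<Rightarrow> complex) \<Rightarrow> (complex \<Rightarrow> complex) \<Rightarrow> complex \<Rightarrow> complex" where
  "weighted_comp F \<phi> f = (\<lambda>z. F z * f (\<phi> z))"

end

theory Submission
  imports Defs
begin

text \<open>
  Surjectivity alone, with (A2)--(A4), forces \<open>\<phi>\<close> to be a conformal automorphism. Writing
  \<open>1 = F (g \<circ> \<phi>)\<close> and \<open>\<chi> = F (h \<circ> \<phi>)\<close> shows that \<open>F\<close> has no zeros and that \<open>z = (h / g) (\<phi> z)\<close>,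
  so \<open>\<phi>\<close> is injective. If \<open>\<phi>\<close> omitted a point \<open>a\<close> of the disk, then \<open>u = \<phi> - a\<close> would be
  admissible in (A4) for \<open>f = F\<close>, since \<open>F u\<^sup>n\<close> is the image of the polynomial \<open>(\<chi> - a)\<^sup>n\<close>. The
  resulting function \<open>F u\<^sup>\<alpha>\<close> has a preimage \<open>h\<close>, an analytic function on the whole disk that
  coincides with a branch of \<open>(w - a)\<^sup>\<alpha>\<close> on the range of \<open>\<phi>\<close>. No such function exists around \<open>a\<close>
  when \<open>\<alpha>\<close> is not an integer.

  The isometry is exploited through (A6). As a function of the constant \<open>C\<close>, the norm
  \<open>\<parallel>\<chi> + C\<parallel> = \<bar>C\<bar> + p(\<chi>)\<close> has a kink only at \<open>C = 0\<close>, whereas the norm of the image is the sum of the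
  convex functions \<open>\<bar>F(0)\<bar> \<bar>\<phi>(0) + C\<bar>\<close> and \<open>p(W \<chi> + C F)\<close> and so has a kink at \<open>C = - \<phi>(0)\<close>;
  hence \<open>\<phi>(0) = 0\<close>. Then \<open>\<bar>F(0)\<bar>\<close> and its reciprocal are the absolute values at \<open>0\<close> of the unit vectors
  \<open>W 1\<close> and \<open>W\<^sup>-\<^sup>1 1\<close>, so both are at most \<open>1\<close>. Thus \<open>\<bar>F(0)\<bar> = 1\<close> and \<open>p(F) = 0\<close>, which makes \<open>F\<close> constant.

  An automorphism of the disk fixing the origin is a rotation by the Schwarz lemma.
\<close>

section \<open>Analytic solutions of the Euler equation\<close>

text \<open>
  The local exponent at \<open>a\<close> of the Euler equation is \<open>\<alpha>\<close>, so comparing it with the order of vanishing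
  of an analytic solution at \<open>a\<close> shows that nontrivial solutions need \<open>\<alpha>\<close> to be a natural number.
  This is the form in which the multivaluedness of \<open>(w - a)\<^sup>\<alpha>\<close> is used below.
\<close>

lemma Euler_equation_nontrivial_solution_exponent:
  fixes h :: "complex \<Rightarrow> complex"
  assumes h: "h holomorphic_on S" and S: "open S" "connected S" and a: "a \<in> S"
    and ode: "\<And>w. w \<in> S \<Longrightarrow> (w - a) * deriv h w = \<alpha> * h w"
    and b: "b \<in> S" "h b \<noteq> 0"
  shows "\<alpha> \<in> \<nat>"
proof (rule ccontr)
  assume nat: "\<alpha> \<notin> \<nat>"
  then have \<alpha>0: "\<alpha> \<noteq> 0" by auto
  then have ha: "h a = 0" using ode[OF a] by auto
  then have "\<not> h constant_on S"
    using a b unfolding constant_on_def by metis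
  then obtain g r n where r: "0 < r" "ball a r \<subseteq> S" and g: "g holomorphic_on ball a r"
    and fac: "\<And>w. w \<in> ball a r \<Longrightarrow> h w = (w - a) ^ n * g w"
    and g0: "\<And>w. w \<in> ball a r \<Longrightarrow> g w \<noteq> 0" and n: "0 < n"
    using holomorphic_factor_zero_nonconstant[OF h S a ha] by metis
  have eq: "(of_nat n - \<alpha>) * g w + (w - a) * deriv g w = 0" if w: "w \<in> ball a r - {a}" for w
  proof -
    have wb: "w \<in> ball a r" and ne: "w - a \<noteq> 0" using w by auto
    have "(g has_field_derivative deriv g w) (at w)"
      using g wb holomorphic_derivI open_ball by blast
    then have "((\<lambda>w. (w - a) ^ n * g w) has_field_derivative
        of_nat n * (w - a) ^ (n - 1) * g w + (w - a) ^ n * deriv g w) (at w)"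
      by (auto intro!: derivative_eq_intros)
    then have "(h has_field_derivative
        of_nat n * (w - a) ^ (n - 1) * g w + (w - a) ^ n * deriv g w) (at w)"
      by (rule has_field_derivative_transform_within_open[OF _ open_ball wb]) (simp add: fac)
    then have dh: "deriv h w = of_nat n * (w - a) ^ (n - 1) * g w + (w - a) ^ n * deriv g w"
      by (rule DERIV_imp_deriv)
    have pw: "(w - a) ^ n = (w - a) * (w - a) ^ (n - 1)"
      using n by (metis power_eq_if not_gr_zero)
    have "d * q * ((of_nat n - \<alpha>) * x + d * y)
        = d * (of_nat n * q * x + d * q * y) - \<alpha> * (d * q * x)" for d q x y :: complex
      by (simp add: algebra_simps)
    then have "(w - a) ^ n * ((of_nat n - \<alpha>) * g w + (w - a) * deriv g w)
        = (w - a) * deriv h w - \<alpha> * h w"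
      unfolding fac[OF wb] dh pw .
    also have "\<dots> = 0" using ode r(2) wb by auto
    finally show ?thesis using ne by simp
  qed
  \<comment> \<open>By continuity the identity extends to \<open>w = a\<close>, where only the term with \<open>n - \<alpha>\<close> survives.\<close>
  have "(of_nat n - \<alpha>) * g a + (a - a) * deriv g a = 0"
  proof (rule analytic_continuation_open[of "ball a r - {a}" "ball a r"
        "\<lambda>w. (of_nat n - \<alpha>) * g w + (w - a) * deriv g w" "\<lambda>_. 0"])
    have "a + of_real (r / 2) \<in> ball a r - {a}" using r(1) by (auto simp: dist_norm)
    then show "ball a r - {a} \<noteq> {}" by blast
    show "(\<lambda>w. (of_nat n - \<alpha>) * g w + (w - a) * deriv g w) holomorphic_on ball a r"
      using g by (intro holomorphic_intros) auto
  qed (use eq r in auto)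
  then have "of_nat n = \<alpha>" using g0[of a] r(1) by simp
  then show False using nat by auto
qed

section \<open>Surjective weighted composition operators\<close>

lemma weighted_comp_onto_nonvanishing:
  assumes "axiom_A2 X" and onto: "weighted_comp F \<phi> ` X = X" and "z \<in> unit_disk"
  shows "F z \<noteq> 0"
proof -
  obtain g where "disk_const 1 = weighted_comp F \<phi> g"
    using assms unfolding axiom_A2_def by blast
  from fun_cong[OF this, of z] show ?thesis
    using assms(3) by (auto simp: weighted_comp_def disk_const_def)
qed

lemma weighted_comp_onto_inj:
  assumes A2: "axiom_A2 X" and A3: "axiom_A3 X" and onto: "weighted_comp F \<phi> ` X = X"
  shows "inj_on \<phi> unit_disk"
proof (rule inj_onI)
  fix z w assume z: "z \<in> unit_disk" and w: "w \<in> unit_disk" and eq: "\<phi> z = \<phi> w"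
  have one: "disk_const 1 \<in> X" using A2 by (simp add: axiom_A2_def)
  then obtain g where g: "disk_const 1 = weighted_comp F \<phi> g"
    using onto by blast
  have "(\<lambda>z. z * disk_const 1 z) \<in> X" using one A3 by (simp add: axiom_A3_def)
  then obtain h where h: "(\<lambda>z. z * disk_const 1 z) = weighted_comp F \<phi> h"
    using onto by blast
  have "g (\<phi> x) \<noteq> 0 \<and> x * g (\<phi> x) = h (\<phi> x)" if x: "x \<in> unit_disk" for x
    using fun_cong[OF g, of x] fun_cong[OF h, of x] x
      weighted_comp_onto_nonvanishing[OF A2 onto x]
    by (auto simp: weighted_comp_def disk_const_def field_simps)
  from this[OF z] this[OF w] eq show "z = w" by (metis mult_right_cancel)
qed

lemma linear_subspace_add:
  "linear_subspace X \<Longrightarrow> f \<in> X \<Longrightarrow> g \<in> X \<Longrightarrow> (\<lambda>z. f z + g z) \<in> X"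
  by (simp add: linear_subspace_def)

lemma linear_subspace_scale:
  "linear_subspace X \<Longrightarrow> f \<in> X \<Longrightarrow> (\<lambda>z. c * f z) \<in> X"
  by (simp add: linear_subspace_def)

lemma disk_const_in_space:
  assumes "linear_subspace X" and "axiom_A2 X"
  shows "disk_const c \<in> X"
proof -
  have "(\<lambda>z. c * disk_const 1 z) \<in> X"
    using assms by (intro linear_subspace_scale) (simp_all add: axiom_A2_def)
  moreover have "(\<lambda>z. c * disk_const 1 z) = disk_const c" by (auto simp: disk_const_def)
  ultimately show ?thesis by simp
qed

lemma shifted_power_in_space:
  assumes lin: "linear_subspace X" and "axiom_A2 X" and A3: "axiom_A3 X"
  shows "(\<lambda>z. (z - a) ^ n * disk_const 1 z) \<in> X"
proof (induction n)
  case 0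
  then show ?case using assms(2) by (simp add: axiom_A2_def)
next
  case (Suc n)
  define q where "q = (\<lambda>z. (z - a) ^ n * disk_const 1 z)"
  have q: "q \<in> X" using Suc by (simp add: q_def)
  then have "(\<lambda>z. z * q z) \<in> X" using A3 by (simp add: axiom_A3_def)
  then have "(\<lambda>z. z * q z + (- a) * q z) \<in> X"
    by (rule linear_subspace_add[OF lin _ linear_subspace_scale[OF lin q]])
  moreover have "(\<lambda>z. z * q z + (- a) * q z) = (\<lambda>z. (z - a) ^ Suc n * disk_const 1 z)"
    by (simp add: q_def algebra_simps)
  ultimately show ?case by simp
qed

text \<open>
  If \<open>\<phi>\<close> omits \<open>a\<close>, axiom (A4) produces an analytic function on the disk that equals
  \<open>(w - a)\<^sup>\<alpha>\<close> on the open set \<open>\<phi> ` unit_disk\<close>. Its Euler equation propagates from there to the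
  whole disk, including \<open>a\<close>.
\<close>

lemma weighted_comp_onto_symbol_onto:
  assumes sub: "X \<subseteq> analytic_disk" and lin: "linear_subspace X"
    and A2: "axiom_A2 X" and A3: "axiom_A3 X" and A4: "axiom_A4 X"
    and F: "F \<in> analytic_disk"
    and hol: "\<phi> holomorphic_on unit_disk" and im: "\<phi> ` unit_disk \<subseteq> unit_disk"
    and onto: "weighted_comp F \<phi> ` X = X"
  shows "\<phi> ` unit_disk = unit_disk"
proof (rule ccontr)
  assume "\<phi> ` unit_disk \<noteq> unit_disk"
  then obtain a where a: "a \<in> unit_disk" "a \<notin> \<phi> ` unit_disk" using im by blast
  have inj: "inj_on \<phi> unit_disk" by (rule weighted_comp_onto_inj[OF A2 A3 onto])
  have F0: "F z = 0" if "z \<notin> unit_disk" for z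
    using F that by (simp add: analytic_disk_def)
  have Fn0: "F z \<noteq> 0" if "z \<in> unit_disk" for z
    by (rule weighted_comp_onto_nonvanishing[OF A2 onto that])
  have \<phi>in: "\<phi> z \<in> unit_disk" if "z \<in> unit_disk" for z using im that by blast
  define u where "u = (\<lambda>z. if z \<in> unit_disk then \<phi> z - a else 0)"
  have u_hol: "u holomorphic_on unit_disk"
    by (rule holomorphic_transform[of "\<lambda>z. \<phi> z - a"]) (auto simp: u_def intro!: holomorphic_intros hol)
  have u_bdd: "bounded (u ` unit_disk)"
  proof -
    have "norm (u z) \<le> 2" if "z \<in> unit_disk" for z
      using norm_triangle_ineq4[of "\<phi> z" a] \<phi>in[OF that] a(1) that by (simp add: u_def)
    then show ?thesis by (intro boundedI) blast
  qed
  have u: "u \<in> H_infinity"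
    using u_hol u_bdd by (simp add: H_infinity_def analytic_disk_def u_def)
  have u0: "u z \<noteq> 0" if "z \<in> unit_disk" for z
    using a(2) that by (auto simp: u_def)
  have pow: "(\<lambda>z. F z * u z ^ n) \<in> X" for n
  proof -
    have "weighted_comp F \<phi> (\<lambda>z. (z - a) ^ n * disk_const 1 z) \<in> X"
      using imageI[OF shifted_power_in_space[OF lin A2 A3], of "weighted_comp F \<phi>" a n]
      by (simp only: onto)
    moreover have "weighted_comp F \<phi> (\<lambda>z. (z - a) ^ n * disk_const 1 z) = (\<lambda>z. F z * u z ^ n)"
      using F0 \<phi>in by (auto simp: fun_eq_iff weighted_comp_def u_def disk_const_def)
    ultimately show ?thesis by simp
  qed
  have FX: "F \<in> X" using pow[of 0] by simp
  obtain \<alpha> :: real and L where \<alpha>: "\<alpha> \<notin> \<int>" and L: "log_branch L u"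
    and mem: "(\<lambda>z. F z * exp (of_real \<alpha> * L z)) \<in> X"
  proof -
    have "(\<forall>z\<in>unit_disk. u z \<noteq> 0) \<and> (\<forall>n\<ge>1. (\<lambda>z. F z * u z ^ n) \<in> X)"
      using u0 pow by simp
    then have "\<exists>\<alpha>::real. \<alpha> > 0 \<and> \<alpha> \<notin> \<int> \<and>
        (\<exists>L. log_branch L u \<and> (\<lambda>z. F z * exp (of_real \<alpha> * L z)) \<in> X)"
      by (rule mp[OF bspec[OF bspec[OF A4[unfolded axiom_A4_def] u] FX]])
    then show thesis using that by (elim exE conjE)
  qed
  obtain h where h: "h \<in> X" and hE: "(\<lambda>z. F z * exp (of_real \<alpha> * L z)) = weighted_comp F \<phi> h"
    using mem onto by blast
  have h\<phi>: "h (\<phi> z) = exp (of_real \<alpha> * L z)" if "z \<in> unit_disk" for z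
    using fun_cong[OF hE, of z] Fn0[OF that] by (simp add: weighted_comp_def)
  have h_hol: "h holomorphic_on unit_disk" using h sub by (auto simp: analytic_disk_def)
  have L_hol: "L holomorphic_on unit_disk" and expL: "\<And>z. z \<in> unit_disk \<Longrightarrow> exp (L z) = \<phi> z - a"
    using L by (auto simp: log_branch_def u_def)
  \<comment> \<open>Logarithmic differentiation of \<open>h \<circ> \<phi> = (\<phi> - a)\<^sup>\<alpha>\<close>; injectivity of \<open>\<phi>\<close> allows cancelling \<open>L'\<close>.\<close>
  have ode_range: "(\<phi> z - a) * deriv h (\<phi> z) = of_real \<alpha> * h (\<phi> z)" if z: "z \<in> unit_disk" for z
  proof -
    have d\<phi>: "(\<phi> has_field_derivative deriv \<phi> z) (at z)"
      and dL: "(L has_field_derivative deriv L z) (at z)"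
      and dh: "(h has_field_derivative deriv h (\<phi> z)) (at (\<phi> z))"
      using hol L_hol h_hol z \<phi>in[OF z] holomorphic_derivI open_ball by blast+
    have "((\<lambda>x. exp (L x) + a) has_field_derivative exp (L z) * deriv L z) (at z)"
      using dL by (auto intro!: derivative_eq_intros)
    then have "(\<phi> has_field_derivative exp (L z) * deriv L z) (at z)"
      by (rule has_field_derivative_transform_within_open[OF _ open_ball z]) (simp add: expL)
    then have 1: "deriv \<phi> z = (\<phi> z - a) * deriv L z"
      using d\<phi> DERIV_unique expL[OF z] by metis
    have "((\<lambda>x. exp (of_real \<alpha> * L x)) has_field_derivative
        exp (of_real \<alpha> * L z) * (of_real \<alpha> * deriv L z)) (at z)"
      using dL by (auto intro!: derivative_eq_intros)
    then have "((\<lambda>x. h (\<phi> x)) has_field_derivative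
        exp (of_real \<alpha> * L z) * (of_real \<alpha> * deriv L z)) (at z)"
      by (rule has_field_derivative_transform_within_open[OF _ open_ball z]) (simp add: h\<phi>)
    moreover have "((\<lambda>x. h (\<phi> x)) has_field_derivative deriv h (\<phi> z) * deriv \<phi> z) (at z)"
      by (rule DERIV_chain2[OF dh d\<phi>])
    ultimately have "deriv h (\<phi> z) * deriv \<phi> z = h (\<phi> z) * (of_real \<alpha> * deriv L z)"
      using DERIV_unique h\<phi>[OF z] by metis
    then have "deriv L z * ((\<phi> z - a) * deriv h (\<phi> z)) = deriv L z * (of_real \<alpha> * h (\<phi> z))"
      using 1 by (simp add: algebra_simps)
    moreover have "deriv L z \<noteq> 0"
      using 1 holomorphic_injective_imp_regular[OF hol open_ball inj z] by auto
    ultimately show ?thesis by simp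
  qed
  have ode: "(w - a) * deriv h w = of_real \<alpha> * h w" if "w \<in> unit_disk" for w
  proof (rule analytic_continuation_open[of "\<phi> ` unit_disk" unit_disk
        "\<lambda>w. (w - a) * deriv h w" "\<lambda>w. of_real \<alpha> * h w"])
    show "open (\<phi> ` unit_disk)" by (rule open_mapping_thm3[OF hol open_ball inj])
    show "(\<lambda>w. (w - a) * deriv h w) holomorphic_on unit_disk"
         "(\<lambda>w. of_real \<alpha> * h w) holomorphic_on unit_disk"
      using h_hol by (auto intro!: holomorphic_intros)
  qed (use im ode_range that in auto)
  have "h (\<phi> 0) \<noteq> 0" "\<phi> 0 \<in> unit_disk" using h\<phi>[of 0] \<phi>in[of 0] by auto
  then have "(of_real \<alpha> :: complex) \<in> \<nat>"
    using Euler_equation_nontrivial_solution_exponent[OF h_hol open_ball connected_ball a(1) ode]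
    by blast
  then have "\<alpha> \<in> \<nat>" by (metis Nats_cases of_real_eq_iff of_real_of_nat_eq of_nat_in_Nats)
  then show False using \<alpha> Nats_subset_Ints by blast
qed

section \<open>Consequences of the isometry\<close>

text \<open>
  The three translates \<open>\<chi>\<close>, \<open>\<chi> - a\<close>, \<open>\<chi> - 2 a\<close> with \<open>a = \<phi> 0\<close> have norms in arithmetic progression.
  The norm of the image is the sum of \<open>\<bar>F(0)\<bar> \<bar>\<phi>(0) + C\<bar>\<close>, whose values \<open>\<bar>F(0) a\<bar>\<close>, \<open>0\<close>, \<open>\<bar>F(0) a\<bar>\<close>
  dip in the middle unless \<open>a = 0\<close>, and of a convex function of \<open>C\<close>, which cannot make up for the dip.
\<close>

lemma isometric_weighted_comp_fixes_origin:
  assumes lin: "linear_subspace X" and A2: "axiom_A2 X" and A3: "axiom_A3 X" and A6: "axiom_A6 X N"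
    and F0: "F 0 \<noteq> 0" and \<phi>0: "\<phi> 0 \<in> unit_disk"
    and into: "weighted_comp F \<phi> ` X \<subseteq> X"
    and iso: "\<forall>f\<in>X. N (weighted_comp F \<phi> f) = N f"
  shows "\<phi> 0 = 0"
proof -
  obtain p where p: "seminorm_on X p"
    and pt: "\<And>f C. f \<in> X \<Longrightarrow> p (\<lambda>z. f z + disk_const C z) = p f"
    and Np: "\<And>f. f \<in> X \<Longrightarrow> N f = cmod (f 0) + p f"
    using A6 unfolding axiom_A6_def by blast
  define a where "a = \<phi> 0"
  define Z where "Z = (\<lambda>z. z * disk_const 1 z)"
  define T where "T = (\<lambda>C. weighted_comp F \<phi> (\<lambda>z. Z z + disk_const C z))"
  have one: "disk_const 1 \<in> X" using A2 by (simp add: axiom_A2_def)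
  have Z: "Z \<in> X" using one A3 by (simp add: axiom_A3_def Z_def)
  have mem: "(\<lambda>z. Z z + disk_const C z) \<in> X" for C
    by (rule linear_subspace_add[OF lin Z disk_const_in_space[OF lin A2]])
  have TX: "T C \<in> X" for C using mem into by (auto simp: T_def)
  have eq: "cmod (F 0) * cmod (a + C) + p (T C) = cmod C + p Z" for C
  proof -
    have "N (T C) = N (\<lambda>z. Z z + disk_const C z)" using iso mem by (simp add: T_def)
    moreover have "T C 0 = F 0 * (a + C)"
      using \<phi>0 by (simp add: T_def weighted_comp_def Z_def disk_const_def a_def)
    ultimately show ?thesis
      using Np[OF TX] Np[OF mem] pt[OF Z]
      by (simp add: norm_mult Z_def disk_const_def)
  qed
  have "(\<lambda>z. T 0 z + T (- 2 * a) z) = (\<lambda>z. 2 * T (- a) z)"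
    by (auto simp: T_def weighted_comp_def disk_const_def algebra_simps)
  moreover have "p (\<lambda>z. T 0 z + T (- 2 * a) z) \<le> p (T 0) + p (T (- 2 * a))"
    and "p (\<lambda>z. 2 * T (- a) z) = 2 * p (T (- a))"
    using p TX by (auto simp: seminorm_on_def)
  ultimately have "2 * p (T (- a)) \<le> p (T 0) + p (T (- 2 * a))" by simp
  then have "cmod (F 0) * cmod a \<le> 0"
    using eq[of 0] eq[of "- a"] eq[of "- 2 * a"] by (simp add: norm_mult)
  then show ?thesis using F0 by (simp add: a_def mult_le_0_iff)
qed

text \<open>
  Both \<open>F = W 1\<close> and a preimage \<open>g\<close> of \<open>1\<close> are unit vectors, and \<open>F(0) g(0) = 1\<close> because the origin is
  fixed. As evaluation at \<open>0\<close> is a contraction by (A6), \<open>F\<close> spends its whole norm at the origin and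
  \<open>p F = 0\<close>; by translation invariance \<open>F - F(0)\<close> then has norm zero.
\<close>

lemma isometric_weighted_comp_weight_constant:
  assumes lin: "linear_subspace X" and N: "norm_on X N"
    and A2: "axiom_A2 X" and A6: "axiom_A6 X N"
    and \<phi>0: "\<phi> 0 = 0" and im: "\<phi> ` unit_disk \<subseteq> unit_disk" and F: "F \<in> analytic_disk"
    and onto: "weighted_comp F \<phi> ` X = X"
    and iso: "\<forall>f\<in>X. N (weighted_comp F \<phi> f) = N f"
  shows "cmod (F 0) = 1" and "\<forall>z\<in>unit_disk. F z = F 0"
proof -
  obtain p where p: "seminorm_on X p"
    and pt: "\<And>f C. f \<in> X \<Longrightarrow> p (\<lambda>z. f z + disk_const C z) = p f"
    and Np: "\<And>f. f \<in> X \<Longrightarrow> N f = cmod (f 0) + p f"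
    using A6 unfolding axiom_A6_def by blast
  have pos: "0 \<le> p f" if "f \<in> X" for f using p that by (simp add: seminorm_on_def)
  have one: "disk_const 1 \<in> X" using A2 by (simp add: axiom_A2_def)
  have zero: "(\<lambda>z. 0) \<in> X" using lin by (simp add: linear_subspace_def)
  have "\<forall>c. p (\<lambda>z. c * 0) = cmod c * p (\<lambda>z. 0)"
    using p bspec[OF _ zero] unfolding seminorm_on_def by fast
  from this[rule_format, of 0] have "p (\<lambda>z. 0) = 0" by simp
  then have "p (disk_const 1) = 0" using pt[OF zero, of 1] by simp
  then have N1: "N (disk_const 1) = 1" using Np[OF one] by (simp add: disk_const_def)
  have F_eq: "weighted_comp F \<phi> (disk_const 1) = F"
  proof
    fix z
    show "weighted_comp F \<phi> (disk_const 1) z = F z"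
    proof (cases "z \<in> unit_disk")
      case True
      then have "\<phi> z \<in> unit_disk" using im by blast
      then show ?thesis by (simp add: weighted_comp_def disk_const_def)
    next
      case False
      then show ?thesis using F by (simp add: weighted_comp_def analytic_disk_def)
    qed
  qed
  have "weighted_comp F \<phi> (disk_const 1) \<in> X"
    using imageI[OF one, of "weighted_comp F \<phi>"] by (simp only: onto)
  then have FX: "F \<in> X" by (simp only: F_eq)
  have NF: "N F = 1" using bspec[OF iso one] by (simp only: F_eq N1)
  obtain g where g: "g \<in> X" and ge: "disk_const 1 = weighted_comp F \<phi> g" using one onto by blast
  have "N g = 1" using bspec[OF iso g] N1 ge by simp
  then have "cmod (g 0) \<le> 1" using Np[OF g] pos[OF g] by simp
  moreover have "F 0 * g 0 = 1"
    using fun_cong[OF ge, of 0] \<phi>0 by (simp add: weighted_comp_def disk_const_def)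
  then have "cmod (F 0) * cmod (g 0) = 1" by (metis norm_mult norm_one)
  ultimately have "1 \<le> cmod (F 0)" by (metis mult_left_le norm_ge_zero)
  then show F1: "cmod (F 0) = 1" using Np[OF FX] pos[OF FX] NF by simp
  then have pF: "p F = 0" using Np[OF FX] NF by simp
  define G where "G = (\<lambda>z. F z + disk_const (- F 0) z)"
  have GX: "G \<in> X"
    unfolding G_def by (rule linear_subspace_add[OF lin FX disk_const_in_space[OF lin A2]])
  have "N G = 0" using Np[OF GX] pt[OF FX] pF by (simp add: G_def disk_const_def)
  then have "G = (\<lambda>z. 0)" using N GX by (simp add: norm_on_def)
  then have "F z + disk_const (- F 0) z = 0" for z unfolding G_def by (rule fun_cong)
  then show "\<forall>z\<in>unit_disk. F z = F 0"
    unfolding disk_const_def by (metis eq_neg_iff_add_eq_0 minus_minus)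
qed

section \<open>Rotations\<close>

lemma disk_automorphism_fixing_origin_is_rotation:
  assumes hol: "\<phi> holomorphic_on unit_disk" and inj: "inj_on \<phi> unit_disk"
    and im: "\<phi> ` unit_disk = unit_disk" and \<phi>0: "\<phi> 0 = 0"
  shows "\<exists>c. cmod c = 1 \<and> (\<forall>z\<in>unit_disk. \<phi> z = c * z)"
proof -
  obtain \<psi> where \<psi>: "\<psi> holomorphic_on unit_disk" and inv: "\<And>z. z \<in> unit_disk \<Longrightarrow> \<psi> (\<phi> z) = z"
    using holomorphic_has_inverse[OF hol open_ball inj] im by metis
  have \<phi>in: "cmod (\<phi> z) < 1" if "cmod z < 1" for z using im that by auto
  have \<psi>in: "cmod (\<psi> w) < 1" if "cmod w < 1" for w
  proof -
    have "w \<in> \<phi> ` unit_disk" using im that by simp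
    then show ?thesis using inv by auto
  qed
  have \<psi>0: "\<psi> 0 = 0" using inv[of 0] \<phi>0 by simp
  define x :: complex where "x = 1 / 2"
  have x: "cmod x < 1" "x \<noteq> 0" by (simp_all add: x_def norm_divide)
  have "cmod (\<phi> x) \<le> cmod x" by (rule Schwarz_Lemma(1)[OF hol \<phi>0 \<phi>in x(1)])
  moreover have "cmod (\<psi> (\<phi> x)) \<le> cmod (\<phi> x)"
    by (rule Schwarz_Lemma(1)[OF \<psi> \<psi>0 \<psi>in \<phi>in[OF x(1)]])
  ultimately have "cmod (\<phi> x) = cmod x" using inv[of x] x by simp
  then have "\<exists>c. (\<forall>z. cmod z < 1 \<longrightarrow> \<phi> z = c * z) \<and> cmod c = 1"
    using Schwarz_Lemma(3)[OF hol \<phi>0 \<phi>in x(1)] x by blast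
  then show ?thesis by auto
qed

theorem theorem2:
  fixes X :: "(complex \<Rightarrow> complex) set"
    and N :: "(complex \<Rightarrow> complex) \<Rightarrow> real"
    and F \<phi> :: "complex \<Rightarrow> complex"
  assumes "banach_space_of_analytic X N"
    and "axiom_A1 X N" and "axiom_A2 X" and "axiom_A3 X" and "axiom_A4 X" and "axiom_A6 X N"
    and "F \<in> analytic_disk"
    and "\<phi> holomorphic_on unit_disk" and "\<phi> ` unit_disk \<subseteq> unit_disk"
    and "weighted_comp F \<phi> ` X = X"
    and "\<forall>f\<in>X. N (weighted_comp F \<phi> f) = N f"
  shows "(\<exists>a. cmod a = 1 \<and> (\<forall>z\<in>unit_disk. F z = a)) \<and>
         (\<exists>c. cmod c = 1 \<and> (\<forall>z\<in>unit_disk. \<phi> z = c * z))"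
proof -
  have sub: "X \<subseteq> analytic_disk" and lin: "linear_subspace X" and N: "norm_on X N"
    using assms(1) by (simp_all add: banach_space_of_analytic_def)
  have F0: "F 0 \<noteq> 0" using weighted_comp_onto_nonvanishing[OF assms(3,10)] by simp
  have "\<phi> 0 \<in> unit_disk" by (rule subsetD[OF assms(9)]) simp
  then have \<phi>0: "\<phi> 0 = 0"
    using isometric_weighted_comp_fixes_origin[OF lin assms(3,4,6) F0 _ _ assms(11)] assms(10)
    by simp
  note F_const = isometric_weighted_comp_weight_constant[OF lin N assms(3,6) \<phi>0 assms(9,7,10,11)]
  have "\<exists>c. cmod c = 1 \<and> (\<forall>z\<in>unit_disk. \<phi> z = c * z)"
    by (rule disk_automorphism_fixing_origin_is_rotation[OF assms(8)
          weighted_comp_onto_inj[OF assms(3,4,10)]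
          weighted_comp_onto_symbol_onto[OF sub lin assms(3,4,5,7,8,9,10)] \<phi>0])
  with F_const show ?thesis by blast
qed

end
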